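(* Let $c,n>1$, and suppose that the Shift Finding problem $\mathsf{ShiftFinding}_{c,n}$ admits a randomized algorithm that makes at most $q=q(c,n)$ (possibly adaptive) queries. Then every pseudo-deterministic streaming algorithm for the approximate counting problem $\mathsf{ApproxCount}_{c,n}$ must use $\Omega\big(\frac{\log n}{\log q}\big)$ bits of space.
   Context: Shift Finding $\mathsf{ShiftFinding}_{c,n}$: the input is a string $P\in\{0,1\}^{(c-1)n}$ (fully known to the algorithm), and the algorithm has query access to a string $F_{s^*}$ which is the concatenation of $n-s^*$ zeros, then $P$, then $s^*$ ones, for an unknown $s^*\in[0,n]$; a query at $x\in[0,cn]$ returns $F_{s^*}(x)$. The goal is to output $s^*$; a randomized algorithm must be correct with probability at least $9/10$, and its cost is the number of queries to $F_{s^*}$. $\mathsf{ApproxCount}_{c,n}$: the input is a stream of length at most $(c+1)n$, and the algorithm must distinguish whether the number of stream items is at most $n$ or greater than $cn$ (correct with probability at least $9/10$ on streams satisfying this promise). A streaming algorithm $A$ is pseudo-deterministic if there is a function $F$ defined on all input streams (including those outside the promise), its canonical function, such that for every stream $\sigma$, $\Pr[A(\sigma)=F(\sigma)]\ge 9/10$ over the algorithm's randomness. Space is measured in bits. *)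

theory Defs
  imports "HOL-Probability.Probability"
begin

section \<open>Shift Finding\<close>

text \<open>
  Here \<open>c\<close> is a real number. When \<open>c * n\<close> is not an integer, the length of \<open>P\<close> is rounded down,
  so that \<open>P\<close> has one bit for each integer \<open>m\<close> with \<open>n < m \<le> c * n\<close>.
\<close>

definition shift_string :: "bool list \<Rightarrow> nat \<Rightarrow> nat \<Rightarrow> bool list" where
  "shift_string P n s = replicate (n - s) False @ P @ replicate s True"

text \<open>
  The characters of the string occupy the positions \<open>1, \<dots>, c * n\<close>. The remaining position \<open>0\<close> of
  the query range \<open>[0, c * n]\<close> holds a \<open>0\<close>, whatever the shift is.
\<close>

definition shift_query :: "bool list \<Rightarrow> nat \<Rightarrow> nat \<Rightarrow> nat \<Rightarrow> bool" where
  "shift_query P n s x = (if x = 0 then False else shift_string P n s ! (x - 1))"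

datatype query_tree = Output nat | Query nat "bool \<Rightarrow> query_tree"

primrec tree_result :: "query_tree \<Rightarrow> (nat \<Rightarrow> bool) \<Rightarrow> nat" where
  "tree_result (Output r) f = r"
| "tree_result (Query x k) f = tree_result (k (f x)) f"

primrec tree_queries :: "query_tree \<Rightarrow> (nat \<Rightarrow> bool) \<Rightarrow> nat list" where
  "tree_queries (Output r) f = []"
| "tree_queries (Query x k) f = x # tree_queries (k (f x)) f"

text \<open>
  A randomized adaptive query algorithm is a random query tree, whose distribution may depend
  arbitrarily on the known string \<open>P\<close>.
\<close>

definition solves_shift_finding ::
    "real \<Rightarrow> nat \<Rightarrow> nat \<Rightarrow> (bool list \<Rightarrow> query_tree pmf) \<Rightarrow> bool" where
  "solves_shift_finding c n q A \<longleftrightarrow>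
     (\<forall>P s. length P = nat \<lfloor>(c - 1) * real n\<rfloor> \<and> s \<le> n \<longrightarrow>
        (\<forall>t \<in> set_pmf (A P).
           (\<forall>x \<in> set (tree_queries t (shift_query P n s)). real x \<le> c * real n) \<and>
           length (tree_queries t (shift_query P n s)) \<le> q) \<and>
        measure_pmf.prob (A P) {t. tree_result t (shift_query P n s) = s} \<ge> 9 / 10)"


section \<open>Streaming algorithms and approximate counting\<close>

text \<open>
  The state of the algorithm is its memory content, a bit string. Fresh coins may be tossed at the
  start, at every update and when producing the output; random bits that are to be reused have to
  be stored in the memory. The update has no access to the number of items read so far.
\<close>

record stream_alg =
  initial :: "bool list pmf"
  update :: "nat \<Rightarrow> bool list \<Rightarrow> bool list pmf"
  answer :: "bool list \<Rightarrow> bool pmf"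

definition stream_state :: "stream_alg \<Rightarrow> nat list \<Rightarrow> bool list pmf" where
  "stream_state B \<sigma> = foldl (\<lambda>M a. bind_pmf M (update B a)) (initial B) \<sigma>"

definition stream_output :: "stream_alg \<Rightarrow> nat list \<Rightarrow> bool pmf" where
  "stream_output B \<sigma> = bind_pmf (stream_state B \<sigma>) (answer B)"

definition uses_space :: "nat list set \<Rightarrow> nat \<Rightarrow> stream_alg \<Rightarrow> bool" where
  "uses_space I S B \<longleftrightarrow> (\<forall>\<sigma> \<in> I. \<forall>w \<in> set_pmf (stream_state B \<sigma>). length w \<le> S)"

definition pseudo_deterministic :: "nat list set \<Rightarrow> stream_alg \<Rightarrow> bool" where
  "pseudo_deterministic I B \<longleftrightarrow>
     (\<exists>F :: nat list \<Rightarrow> bool. \<forall>\<sigma> \<in> I. pmf (stream_output B \<sigma>) (F \<sigma>) \<ge> 9 / 10)"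

definition count_streams :: "nat set \<Rightarrow> real \<Rightarrow> nat \<Rightarrow> nat list set" where
  "count_streams U c n = {\<sigma> \<in> lists U. real (length \<sigma>) \<le> (c + 1) * real n}"

text \<open>The answer \<open>False\<close> stands for ``at most \<open>n\<close> items'', \<open>True\<close> for ``more than \<open>c * n\<close> items''.\<close>

definition solves_approx_count :: "nat set \<Rightarrow> real \<Rightarrow> nat \<Rightarrow> stream_alg \<Rightarrow> bool" where
  "solves_approx_count U c n B \<longleftrightarrow>
     (\<forall>\<sigma> \<in> count_streams U c n.
        (length \<sigma> \<le> n \<longrightarrow> pmf (stream_output B \<sigma>) False \<ge> 9 / 10) \<and>
        (real (length \<sigma>) > c * real n \<longrightarrow> pmf (stream_output B \<sigma>) True \<ge> 9 / 10))"

end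

theory Submission imports Defs begin

text \<open>
  On a unary stream the canonical function is a bit string \<open>f\<close> indexed by the number of items, and
  the bits that can be reached after \<open>s \<le> n\<close> items are exactly the shift finding instance with
  shift \<open>s\<close> whose known string is \<open>f\<close> restricted to \<open>n < m \<le> c * n\<close>. Hence the states of
  \<open>k = O(log q)\<close> independent copies of the streaming algorithm after \<open>s\<close> items encode \<open>s\<close>: a query
  at \<open>x\<close> is answered by feeding \<open>x\<close> more items to every copy and averaging, and the averages are
  correct on all \<open>q\<close> queries of the true query path with constant probability. Decoding \<open>n + 1\<close>
  values with constant probability requires a linear number of state tuples, so
  \<open>2 ^ ((S + 1) * k)\<close> is at least linear in \<open>n\<close>.
\<close>

subsection \<open>Concentration of independent averages\<close>

text \<open>Convexity puts the exponential below its chord. This turns a bound on the mean of a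
  variable with values in \<open>[0, 1]\<close> into one on its moment generating function.\<close>

lemma powr_9_le_linear:
  fixes x :: real
  assumes "0 \<le> x" "x \<le> 1"
  shows "9 powr x \<le> 1 + 8 * x"
proof -
  have "exp ((1 - x) *\<^sub>R 0 + x *\<^sub>R ln 9) \<le> (1 - x) * exp 0 + x * exp (ln (9 :: real))"
    using assms by (intro convex_onD[OF exp_convex]) auto
  then show ?thesis
    by (simp add: powr_def algebra_simps)
qed

text \<open>Chernoff's method with base 9: each factor has mean at most
  \<open>1 + 8 / 10 = 9 / 5\<close>, the threshold becomes \<open>9 powr (k / 2) = 3 ^ k\<close>,
  and Markov's inequality gives the quotient. Base 9 minimises this quotient for mean
  \<open>1 / 10\<close>.\<close>

lemma prob_Pi_pmf_sum_ge_half: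
  fixes X :: "'a \<Rightarrow> real"
  assumes X: "\<And>w. 0 \<le> X w" "\<And>w. X w \<le> 1"
    and mean: "measure_pmf.expectation M X \<le> 1 / 10"
  shows "measure_pmf.prob (Pi_pmf {..<k} d (\<lambda>_. M)) {w. (\<Sum>i<k. X (w i)) \<ge> real k / 2} \<le> (3 / 5) ^ k"
proof -
  let ?Q = "Pi_pmf {..<k} d (\<lambda>_. M)"
  define Y where "Y w = (\<Prod>i<k. 9 powr X (w i))" for w :: "nat \<Rightarrow> 'a"
  have bound: "9 powr X w \<le> 9" for w
    using X[of w] powr_mono[of "X w" 1 "9 :: real"] by simp
  have int1: "integrable (measure_pmf M) (\<lambda>w. 9 powr X w)"
    by (rule measure_pmf.integrable_const_bound[where B = 9]) (auto intro!: AE_pmfI bound)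
  have intX: "integrable (measure_pmf M) X"
    by (rule measure_pmf.integrable_const_bound[where B = 1]) (auto intro!: AE_pmfI simp: X)
  have "Y w \<le> 9 ^ k" for w
    unfolding Y_def using prod_mono[of "{..<k}" "\<lambda>i. 9 powr X (w i)" "\<lambda>_. 9"] bound by simp
  moreover have Y_nonneg: "Y w \<ge> 0" for w
    unfolding Y_def by (intro prod_nonneg) auto
  ultimately have intY: "integrable (measure_pmf ?Q) Y"
    by (intro measure_pmf.integrable_const_bound[where B = "9 ^ k"]) (auto intro!: AE_pmfI)
  have "measure_pmf.expectation M (\<lambda>w. 9 powr X w) \<le> measure_pmf.expectation M (\<lambda>w. 1 + 8 * X w)"
    using int1 intX powr_9_le_linear X by (intro integral_mono) auto
  also have "\<dots> = 1 + 8 * measure_pmf.expectation M X"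
    using intX by simp
  finally have mgf: "measure_pmf.expectation M (\<lambda>w. 9 powr X w) \<le> 9 / 5"
    using mean by simp
  have "measure_pmf.expectation ?Q Y = (\<Prod>i<k. measure_pmf.expectation M (\<lambda>w. 9 powr X w))"
    unfolding Y_def by (rule expectation_prod_Pi_pmf) (auto intro: int1)
  also have "\<dots> \<le> (9 / 5) ^ k"
    using mgf by (simp add: power_mono)
  finally have EY: "measure_pmf.expectation ?Q Y \<le> (9 / 5) ^ k" .
  have "Y w \<ge> 3 ^ k" if "(\<Sum>i<k. X (w i)) \<ge> real k / 2" for w
  proof -
    have "Y w = 9 powr (\<Sum>i<k. X (w i))"
      by (simp add: Y_def powr_sum)
    also have "\<dots> \<ge> 9 powr (real k / 2)"
      using that by (intro powr_mono) auto
    also have "9 powr (real k / 2) = (9 powr (1 / 2)) powr real k"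
      by (simp add: powr_powr)
    also have "\<dots> = (3 :: real) ^ k"
      using real_sqrt_unique[of 3 9] by (simp add: powr_realpow powr_half_sqrt)
    finally show ?thesis .
  qed
  then have "measure_pmf.prob ?Q {w. (\<Sum>i<k. X (w i)) \<ge> real k / 2} \<le> measure_pmf.prob ?Q {w. Y w \<ge> 3 ^ k}"
    by (intro measure_pmf.finite_measure_mono) auto
  also have "\<dots> \<le> measure_pmf.expectation ?Q Y / 3 ^ k"
    using integral_Markov_inequality_measure[OF intY, of "{}" "3 ^ k"] Y_nonneg by simp
  also have "\<dots> \<le> (9 / 5) ^ k / 3 ^ k"
    using EY by (intro divide_right_mono) auto
  also have "\<dots> = (3 / 5) ^ k"
    by (simp flip: power_divide)
  finally show ?thesis .
qed


subsection \<open>Query trees\<close>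

lemma tree_result_cong:
  assumes "\<And>x. x \<in> set (tree_queries t f) \<Longrightarrow> g x = f x"
  shows "tree_result t g = tree_result t f"
  using assms by (induction t) auto


subsection \<open>Resuming a streaming algorithm from a state\<close>

lemma foldl_bind_pmf:
  "foldl (\<lambda>M a. bind_pmf M (g a)) M \<tau> =
     bind_pmf M (\<lambda>w. foldl (\<lambda>M a. bind_pmf M (g a)) (return_pmf w) \<tau>)"
proof (induction \<tau> arbitrary: M)
  case Nil
  then show ?case by (simp add: bind_return_pmf')
next
  case (Cons a \<tau>)
  show ?case
    by (simp add: bind_return_pmf) (subst (1 2) Cons.IH, simp add: bind_assoc_pmf)
qed

definition resume :: "stream_alg \<Rightarrow> nat list \<Rightarrow> bool list \<Rightarrow> bool pmf" where
  "resume B \<tau> w = stream_output (B\<lparr>initial := return_pmf w\<rparr>) \<tau>"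

lemma stream_output_append:
  "stream_output B (\<sigma> @ \<tau>) = bind_pmf (stream_state B \<sigma>) (resume B \<tau>)"
proof -
  have "stream_state B (\<sigma> @ \<tau>) =
      bind_pmf (stream_state B \<sigma>) (\<lambda>w. stream_state (B\<lparr>initial := return_pmf w\<rparr>) \<tau>)"
    unfolding stream_state_def by (simp, subst foldl_bind_pmf, simp)
  then show ?thesis
    by (simp add: stream_output_def resume_def[abs_def] bind_assoc_pmf)
qed

text \<open>The probabilities of answering \<open>True\<close> are averaged exactly, not sampled, so
  decoding with a fixed tree is a deterministic function of the state tuple.\<close>

definition vote :: "stream_alg \<Rightarrow> nat \<Rightarrow> nat \<Rightarrow> (nat \<Rightarrow> bool list) \<Rightarrow> nat \<Rightarrow> bool" where
  "vote B u k w x \<longleftrightarrow> (\<Sum>i<k. pmf (resume B (replicate x u) (w i)) True) > real k / 2"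

text \<open>Averaged over the state after \<sigma>, the resumed answer has the output distribution
  of the whole stream, so the mean error of one copy is at most \<open>1 / 10\<close>.\<close>

lemma prob_vote_wrong:
  assumes "pmf (stream_output B (\<sigma> @ replicate x u)) b \<ge> 9 / 10"
  shows "measure_pmf.prob (Pi_pmf {..<k} d (\<lambda>_. stream_state B \<sigma>)) {w. vote B u k w x \<noteq> b} \<le> (3 / 5) ^ k"
proof -
  let ?M = "stream_state B \<sigma>"
  define h where "h w = pmf (resume B (replicate x u) w) b" for w
  have h: "0 \<le> h w" "h w \<le> 1" for w
    by (auto simp: h_def pmf_le_1)
  have int: "integrable (measure_pmf ?M) h"
    by (rule measure_pmf.integrable_const_bound[where B = 1]) (auto intro!: AE_pmfI simp: h)
  have "measure_pmf.expectation ?M h \<ge> 9 / 10"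
    using assms by (simp add: stream_output_append pmf_bind h_def[abs_def])
  then have mean: "measure_pmf.expectation ?M (\<lambda>w. 1 - h w) \<le> 1 / 10"
    using int by simp
  \<comment> \<open>A tie votes \<open>False\<close>, hence the non-strict inequality, which is
    needed when \<open>b\<close> is \<open>True\<close>.\<close>
  have "(\<Sum>i<k. 1 - h (w i)) \<ge> real k / 2" if "vote B u k w x \<noteq> b" for w
    using that by (cases b) (auto simp: vote_def h_def pmf_False_conv_True sum_subtractf)
  then have "measure_pmf.prob (Pi_pmf {..<k} d (\<lambda>_. ?M)) {w. vote B u k w x \<noteq> b} \<le>
      measure_pmf.prob (Pi_pmf {..<k} d (\<lambda>_. ?M)) {w. (\<Sum>i<k. 1 - h (w i)) \<ge> real k / 2}"
    by (intro measure_pmf.finite_measure_mono) auto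
  also have "\<dots> \<le> (3 / 5) ^ k"
    by (rule prob_Pi_pmf_sum_ge_half) (use h mean in auto)
  finally show ?thesis .
qed

text \<open>Votes that agree with \<open>f\<close> on the path taken under \<open>f\<close> make the
  tree follow that same path. A union bound over its at most \<open>q\<close> queries therefore
  suffices despite adaptivity.\<close>

lemma prob_decode_ge:
  assumes correct: "\<And>x. x \<in> set (tree_queries t f) \<Longrightarrow>
      pmf (stream_output B (\<sigma> @ replicate x u)) (f x) \<ge> 9 / 10"
    and len: "length (tree_queries t f) \<le> q"
  shows "measure_pmf.prob (Pi_pmf {..<k} d (\<lambda>_. stream_state B \<sigma>))
      {w. tree_result t (vote B u k w) = tree_result t f} \<ge> 1 - real q * (3 / 5) ^ k"
proof -
  let ?Q = "Pi_pmf {..<k} d (\<lambda>_. stream_state B \<sigma>)"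
  let ?X = "set (tree_queries t f)"
  let ?bad = "\<Union>x\<in>?X. {w. vote B u k w x \<noteq> f x}"
  have "measure_pmf.prob ?Q ?bad \<le> (\<Sum>x\<in>?X. measure_pmf.prob ?Q {w. vote B u k w x \<noteq> f x})"
    by (rule measure_pmf.finite_measure_subadditive_finite) auto
  also have "\<dots> \<le> real (card ?X) * (3 / 5) ^ k"
    by (intro sum_bounded_above prob_vote_wrong correct)
  also have "\<dots> \<le> real q * (3 / 5) ^ k"
    using card_length[of "tree_queries t f"] len by (intro mult_right_mono) auto
  finally have "1 - real q * (3 / 5) ^ k \<le> measure_pmf.prob ?Q (- ?bad)"
    using measure_pmf.prob_compl[of ?bad ?Q] by (simp add: Compl_eq_Diff_UNIV)
  also have "\<dots> \<le> measure_pmf.prob ?Q {w. tree_result t (vote B u k w) = tree_result t f}"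
    by (intro measure_pmf.finite_measure_mono) (auto intro!: tree_result_cong)
  finally show ?thesis .
qed


subsection \<open>Counting state tuples\<close>

text \<open>Each \<open>w\<close> decodes to a single value, so after exchanging the sums it
  contributes at most 1.\<close>

lemma sum_prob_decode_le_card:
  fixes g :: "'a \<Rightarrow> nat"
  assumes "finite W" and "\<And>s. s \<le> n \<Longrightarrow> set_pmf (D s) \<subseteq> W"
  shows "(\<Sum>s\<le>n. measure_pmf.prob (D s) {w. g w = s}) \<le> real (card W)"
proof -
  have "measure_pmf.prob (D s) {w. g w = s} \<le> (\<Sum>w\<in>W. if g w = s then 1 else 0)" if "s \<le> n" for s
  proof -
    have "measure_pmf.prob (D s) {w. g w = s} = measure_pmf.prob (D s) {w \<in> W. g w = s}"
      using assms(2)[OF that] by (intro measure_pmf.finite_measure_eq_AE AE_pmfI) auto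
    also have "\<dots> = (\<Sum>w\<in>{w \<in> W. g w = s}. pmf (D s) w)"
      using assms(1) by (intro measure_measure_pmf_finite) auto
    also have "\<dots> \<le> (\<Sum>w\<in>{w \<in> W. g w = s}. 1)"
      by (intro sum_mono pmf_le_1)
    also have "\<dots> = (\<Sum>w\<in>W. if g w = s then 1 else 0)"
      using assms(1) by (rule sum.inter_filter)
    finally show ?thesis .
  qed
  then have "(\<Sum>s\<le>n. measure_pmf.prob (D s) {w. g w = s}) \<le>
      (\<Sum>s\<le>n. \<Sum>w\<in>W. if g w = s then 1 else 0)"
    by (intro sum_mono) auto
  also have "\<dots> = (\<Sum>w\<in>W. \<Sum>s\<le>n. if g w = s then 1 else 0)"
    by (rule sum.swap)
  also have "\<dots> \<le> (\<Sum>w\<in>W. 1)"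
    by (intro sum_mono) auto
  finally show ?thesis by simp
qed

lemma card_bool_lists_length_le:
  "card {w :: bool list. length w \<le> S} = 2 ^ Suc S - 1"
proof -
  have "(\<Sum>i\<le>S. (2 :: nat) ^ i) = 2 ^ Suc S - 1"
    by (induction S) auto
  then show ?thesis
    using card_lists_length_le[of "UNIV :: bool set" S] by simp
qed

lemma finite_bool_lists_length_le: "finite {w :: bool list. length w \<le> S}"
  using finite_lists_length_le[of "UNIV :: bool set" S] by simp


subsection \<open>The canonical function as a shift finding instance\<close>

text \<open>The values forced by \<open>lo\<close> and \<open>hi\<close> are the padding of the
  shifted string; \<open>P\<close> records the values of \<open>f\<close> in the gap between
  them.\<close>

lemma shift_query_eq:
  fixes c :: real and f :: "nat \<Rightarrow> bool"
  assumes "c > 1" "s \<le> n" "real x \<le> c * real n"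
    and lo: "\<And>m. m \<le> n \<Longrightarrow> \<not> f m"
    and hi: "\<And>m. c * real n < real m \<Longrightarrow> real m \<le> (c + 1) * real n \<Longrightarrow> f m"
    and P: "P = map (\<lambda>i. f (n + 1 + i)) [0..<nat \<lfloor>(c - 1) * real n\<rfloor>]"
  shows "shift_query P n s x = f (s + x)"
proof (cases "x = 0")
  case True
  then show ?thesis using lo assms(2) by (simp add: shift_query_def)
next
  case False
  define L where "L = nat \<lfloor>(c - 1) * real n\<rfloor>"
  have "real L = \<lfloor>(c - 1) * real n\<rfloor>"
    using assms(1) by (simp add: L_def)
  \<comment> \<open>Rounding loses nothing: \<open>n + L\<close> is the largest integer not
    exceeding \<open>c * n\<close>.\<close>
  then have L: "real L \<le> (c - 1) * real n" "(c - 1) * real n < real L + 1"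
    by linarith+
  have lenP: "length P = L"
    by (simp add: P L_def)
  have xL: "x \<le> n + L"
  proof -
    have "real x < real (n + L + 1)"
      using assms(3) L(2) by (simp add: algebra_simps)
    then show ?thesis by linarith
  qed
  \<comment> \<open>The cases are the leading zeros, the characters of \<open>P\<close> and the
    trailing ones.\<close>
  consider "x + s \<le> n" | "n < x + s" "x + s \<le> n + L" | "n + L < x + s" by linarith
  then show ?thesis
  proof cases
    case 1
    then show ?thesis using False lo[of "s + x"]
      by (simp add: shift_query_def shift_string_def nth_append)
  next
    case 2
    have "x - 1 - (n - s) = x + s - n - 1" using 2 False assms(2) by linarith
    moreover have "\<not> x - 1 < n - s" using 2 False assms(2) by linarith
    moreover have "x + s - n - 1 < L" using 2 by linarith
    moreover have "Suc (n + (x + s - Suc n)) = s + x" using 2 by linarith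
    ultimately show ?thesis using False lenP
      by (simp add: shift_query_def shift_string_def nth_append P L_def add.commute)
  next
    case 3
    have "real (n + L + 1) \<le> real (s + x)" using 3 by linarith
    then have "c * real n < real (s + x)"
      using L(2) by (simp add: algebra_simps)
    moreover have "real (s + x) \<le> (c + 1) * real n"
      using assms(2,3) by (simp add: algebra_simps)
    ultimately have "f (s + x)" by (rule hi)
    moreover have "\<not> x - 1 < n - s" "\<not> x - 1 - (n - s) < L" "x - 1 - (n - s) - L < s"
      using 3 False assms(2) xL by linarith+
    ultimately show ?thesis using False lenP
      by (simp add: shift_query_def shift_string_def nth_append)
  qed
qed


subsection \<open>The lower bound\<close>

lemma linear_le_state_tuples:
  fixes c :: real
  assumes c: "c > 1"
    and A: "solves_shift_finding c n q A"
    and u: "u \<in> U"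
    and pd: "pseudo_deterministic (count_streams U c n) B"
    and ac: "solves_approx_count U c n B"
    and sp: "uses_space (count_streams U c n) S B"
    and k: "real q * (3 / 5) ^ k \<le> 2 / 5"
  shows "(real n + 1) / 2 \<le> real ((2 ^ Suc S - 1) ^ k)"
proof -
  obtain F where F: "\<And>\<sigma>. \<sigma> \<in> count_streams U c n \<Longrightarrow> pmf (stream_output B \<sigma>) (F \<sigma>) \<ge> 9 / 10"
    using pd by (auto simp: pseudo_deterministic_def)
  define f where "f m = F (replicate m u)" for m
  have mem: "replicate m u \<in> count_streams U c n" if "real m \<le> (c + 1) * real n" for m
    using u that by (auto simp: count_streams_def in_lists_conv_set)
  have f: "pmf (stream_output B (replicate m u)) (f m) \<ge> 9 / 10" if "real m \<le> (c + 1) * real n" for m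
    using F[OF mem[OF that]] by (simp add: f_def)
  have lo: "\<not> f m" if "m \<le> n" for m
  proof -
    have m: "real m \<le> (c + 1) * real n"
      using that c mult_right_mono[of 1 "c + 1" "real n"] by linarith
    then have "pmf (stream_output B (replicate m u)) False \<ge> 9 / 10"
      using ac mem that by (auto simp: solves_approx_count_def)
    then show ?thesis
      using f[OF m] by (cases "f m") (auto simp: pmf_False_conv_True)
  qed
  have hi: "f m" if "c * real n < real m" "real m \<le> (c + 1) * real n" for m
  proof -
    have "pmf (stream_output B (replicate m u)) True \<ge> 9 / 10"
      using ac mem that by (auto simp: solves_approx_count_def)
    then show ?thesis
      using f[OF that(2)] by (cases "f m") (auto simp: pmf_False_conv_True)
  qed
  define P where "P = map (\<lambda>i. f (n + 1 + i)) [0..<nat \<lfloor>(c - 1) * real n\<rfloor>]"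
  have lenP: "length P = nat \<lfloor>(c - 1) * real n\<rfloor>"
    by (simp add: P_def)
  have sq: "shift_query P n s x = f (s + x)" if "s \<le> n" "real x \<le> c * real n" for s x
    using shift_query_eq[OF c that lo hi P_def] by blast
  have A_queries: "real x \<le> c * real n"
    if "t \<in> set_pmf (A P)" "s \<le> n" "x \<in> set (tree_queries t (shift_query P n s))" for t s x
    using A lenP that by (auto simp: solves_shift_finding_def)
  have A_len: "length (tree_queries t (shift_query P n s)) \<le> q"
    if "t \<in> set_pmf (A P)" "s \<le> n" for t s
    using A lenP that by (auto simp: solves_shift_finding_def)
  have A_prob: "measure_pmf.prob (A P) {t. tree_result t (shift_query P n s) = s} \<ge> 9 / 10"
    if "s \<le> n" for s
    using A lenP that by (auto simp: solves_shift_finding_def)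

  define D where "D s = Pi_pmf {..<k} [] (\<lambda>_. stream_state B (replicate s u))" for s
  \<comment> \<open>Fixing the value \<open>[]\<close> outside \<open>{..<k}\<close> makes the set
    of tuples finite.\<close>
  define W where "W = PiE_dflt {..<k} [] (\<lambda>_. {w :: bool list. length w \<le> S})"
  have finW: "finite W"
    unfolding W_def by (intro finite_PiE_dflt finite_bool_lists_length_le) auto
  have cardW: "card W = (2 ^ Suc S - 1) ^ k"
    unfolding W_def by (subst card_PiE_dflt) (auto simp: finite_bool_lists_length_le card_bool_lists_length_le)
  have DW: "set_pmf (D s) \<subseteq> W" if "s \<le> n" for s
  proof -
    have "real s \<le> (c + 1) * real n"
      using that c mult_right_mono[of 1 "c + 1" "real n"] by linarith
    then have "length w \<le> S" if "w \<in> set_pmf (stream_state B (replicate s u))" for w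
      using sp mem that by (auto simp: uses_space_def)
    then show ?thesis
      by (auto simp: D_def W_def set_Pi_pmf PiE_dflt_def)
  qed

  \<comment> \<open>With the tree fixed, every shift on which it is correct is decoded with
    probability at least \<open>1 - 2 / 5\<close>. Averaging over the trees comes
    afterwards.\<close>
  have tree_bound: "(\<Sum>s\<le>n. 3 / 5 * indicator {t. tree_result t (shift_query P n s) = s} t) \<le> real (card W)"
    if t: "t \<in> set_pmf (A P)" for t
  proof -
    have "3 / 5 \<le> measure_pmf.prob (D s) {w. tree_result t (vote B u k w) = s}"
      if s: "s \<le> n" and good: "tree_result t (shift_query P n s) = s" for s
    proof -
      have "pmf (stream_output B (replicate s u @ replicate x u)) (shift_query P n s x) \<ge> 9 / 10"
        if "x \<in> set (tree_queries t (shift_query P n s))" for x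
      proof -
        have x: "real x \<le> c * real n"
          using A_queries t s that by blast
        have "real (s + x) \<le> (c + 1) * real n"
          using x s by (simp add: algebra_simps)
        then show ?thesis
          using f[of "s + x"] sq[OF s x] by (simp add: replicate_add)
      qed
      then have "1 - real q * (3 / 5) ^ k \<le>
          measure_pmf.prob (D s) {w. tree_result t (vote B u k w) = tree_result t (shift_query P n s)}"
        unfolding D_def by (intro prob_decode_ge A_len t s)
      then show ?thesis
        using k good by simp
    qed
    then have "(\<Sum>s\<le>n. 3 / 5 * indicator {t. tree_result t (shift_query P n s) = s} t) \<le>
        (\<Sum>s\<le>n. measure_pmf.prob (D s) {w. tree_result t (vote B u k w) = s})"
      by (intro sum_mono) (auto simp: indicator_def)
    also have "\<dots> \<le> real (card W)"
      by (rule sum_prob_decode_le_card) (use finW DW in auto)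
    finally show ?thesis .
  qed

  have int: "integrable (measure_pmf (A P)) (\<lambda>t. 3 / 5 * indicat_real (X s) t)" for X :: "nat \<Rightarrow> query_tree set" and s
    by (rule measure_pmf.integrable_const_bound[where B = 1]) (auto intro!: AE_pmfI simp: indicator_def)
  have "(real n + 1) * (27 / 50) = (\<Sum>s\<le>n. 3 / 5 * (9 / 10))"
    by simp
  also have "\<dots> \<le> (\<Sum>s\<le>n. 3 / 5 * measure_pmf.prob (A P) {t. tree_result t (shift_query P n s) = s})"
    using A_prob by (intro sum_mono mult_left_mono) auto
  also have "\<dots> = measure_pmf.expectation (A P)
      (\<lambda>t. \<Sum>s\<le>n. 3 / 5 * indicator {t. tree_result t (shift_query P n s) = s} t)"
    by (subst Bochner_Integration.integral_sum, rule int) simp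
  also have "\<dots> \<le> measure_pmf.expectation (A P) (\<lambda>_. real (card W))"
    using tree_bound
    by (intro integral_mono_AE AE_pmfI Bochner_Integration.integrable_sum int) auto
  also have "\<dots> = real ((2 ^ Suc S - 1) ^ k)"
    by (simp add: cardW)
  finally show ?thesis by simp
qed

lemma space_lower_bound:
  fixes n k S :: nat
  assumes "n > 1" and le: "(real n + 1) / 2 \<le> real ((2 ^ Suc S - 1) ^ k)"
  shows "log 2 (real n) \<le> 4 * real S * real k"
proof -
  \<comment> \<open>For \<open>S = 0\<close> the right-hand side of \<open>le\<close> is 1, but the
    left-hand side exceeds 1.\<close>
  have "S \<noteq> 0"
    using assms by (auto intro!: Nat.gr0I)
  then have "Suc S \<le> 2 * S" by simp
  \<comment> \<open>Passing to the square root absorbs the factor \<open>1 / 2\<close> and only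
    halves the logarithm.\<close>
  have "sqrt (real n) * 1 \<le> (real n + 1) / 2"
    using arith_geo_mean_sqrt[of "real n" 1] by simp
  also have "\<dots> \<le> real ((2 ^ Suc S - 1) ^ k)"
    by (rule le)
  also have "\<dots> \<le> real ((2 ^ (2 * S)) ^ k)"
  proof -
    have "(2 :: nat) ^ Suc S - 1 \<le> 2 ^ Suc S" by (rule diff_le_self)
    also have "\<dots> \<le> 2 ^ (2 * S)" using \<open>Suc S \<le> 2 * S\<close> by (rule power_increasing) simp
    finally show ?thesis by (intro of_nat_mono power_mono) auto
  qed
  also have "\<dots> = 2 ^ (2 * S * k)"
    by (simp add: power_mult)
  finally have "log 2 (sqrt (real n)) \<le> log 2 (2 ^ (2 * S * k))"
    using assms(1) by (subst log_le_cancel_iff) auto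
  moreover have "log 2 (sqrt (real n)) = log 2 (real n) / 2"
    using assms(1) by (simp add: log_def ln_sqrt)
  ultimately show ?thesis
    by (simp add: log_nat_power)
qed

theorem theorem1p5:
  "\<exists>K > 0. \<forall>(c :: real) (n :: nat) (q :: nat).
     c > 1 \<longrightarrow> n > 1 \<longrightarrow> (\<exists>A. solves_shift_finding c n q A) \<longrightarrow>
     (\<forall>(U :: nat set) (S :: nat) (B :: stream_alg).
        U \<noteq> {} \<longrightarrow>
        pseudo_deterministic (count_streams U c n) B \<longrightarrow>
        solves_approx_count U c n B \<longrightarrow>
        uses_space (count_streams U c n) S B \<longrightarrow>
        real S \<ge> K * (log 2 (real n) / log 2 (real q)))"
\<comment> \<open>The constant 32 is \<open>4 * 4 * 2\<close>: from
  \<open>space_lower_bound\<close>, from \<open>k = 4 * l\<close>, and from rounding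
  \<open>log 2 q\<close> up to \<open>l\<close>.\<close>
proof (intro exI[of _ "1 / 32"] conjI allI impI)
  fix c :: real and n q S :: nat and U :: "nat set" and B :: stream_alg
  assume c: "c > 1" and n: "n > 1" and A: "\<exists>A. solves_shift_finding c n q A" and U: "U \<noteq> {}"
    and B: "pseudo_deterministic (count_streams U c n) B" "solves_approx_count U c n B"
      "uses_space (count_streams U c n) S B"
  show "real S \<ge> 1 / 32 * (log 2 (real n) / log 2 (real q))"
  proof (cases "q \<ge> 2")
    case False
    then have "q = 0 \<or> q = 1" by auto
    \<comment> \<open>For \<open>q = 0\<close> this rests on \<open>ln 0 = 0\<close>; division by
      zero then makes the claimed bound 0.\<close>
    then have "log 2 (real q) = 0" by (auto simp: log_def)
    then show ?thesis by simp
  next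
    case True
    have logq: "log 2 (real q) \<ge> 1" using True by simp
    define l where "l = nat \<lceil>log 2 (real q)\<rceil>"
    have l: "log 2 (real q) \<le> real l" "real l \<le> 2 * log 2 (real q)"
      using logq unfolding l_def by linarith+
    then have "l \<ge> 1" using logq by linarith
    have "real q = 2 powr log 2 (real q)" using True by simp
    also have "\<dots> \<le> 2 powr real l" using l by (intro powr_mono) auto
    also have "\<dots> = 2 ^ l" by (simp add: powr_realpow)
    finally have "real q * (3 / 5) ^ (4 * l) \<le> 2 ^ l * (3 / 5) ^ (4 * l)"
      by (intro mult_right_mono) auto
    \<comment> \<open>The exponent 4 is the least one with
      \<open>2 * (3 / 5) ^ 4 \<le> 2 / 5\<close>.\<close>
    also have "\<dots> = (2 * (3 / 5) ^ 4) ^ l"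
      by (simp add: power_mult power_mult_distrib)
    also have "\<dots> \<le> (2 * (3 / 5) ^ 4) ^ 1"
      using \<open>l \<ge> 1\<close> by (intro power_decreasing) (auto simp: power_divide)
    also have "\<dots> \<le> (2 / 5 :: real)"
      by (simp add: power_divide)
    finally have k: "real q * (3 / 5) ^ (4 * l) \<le> 2 / 5" .
    obtain u where "u \<in> U" using U by blast
    have "log 2 (real n) \<le> 4 * real S * real (4 * l)"
      using A linear_le_state_tuples[OF c _ \<open>u \<in> U\<close> B k] space_lower_bound[OF n] by blast
    also have "\<dots> \<le> 32 * real S * log 2 (real q)"
      using mult_left_mono[OF l(2), of "16 * real S"] by simp
    finally show ?thesis
      using logq by (simp add: field_simps)
  qed
qed simp

end
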